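(* The logic IvFDE_T is a conservative expansion of both IDM4 and Tm. That is: (a) for every set of formulas Γ ∪ {φ} over the signature {∧, ∨, →, ¬} of IDM4, Γ ⊢_{IvFDE_T} φ iff Γ ⊢_{IDM4} φ; and (b) for every set of formulas Γ ∪ {φ} over the signature {→, ∼, □} of Tm, Γ ⊢_{IvFDE_T} φ iff Γ ⊢_{Tm} φ.
   Context: IDM4 (Pynko's 4-valued expansion of Belnap–Dunn's logic FDE by an implication) is the logic over the signature {∧, ∨, →, ¬} given by the Hilbert calculus with modus ponens and the axiom schemas: (Ax1) φ→(ψ→φ); (Ax2) (φ→(ψ→γ))→((φ→ψ)→(φ→γ)); (Ax3) φ→(ψ→(φ∧ψ)); (Ax4) (φ∧ψ)→φ; (Ax5) (φ∧ψ)→ψ; (Ax6) φ→(φ∨ψ); (Ax7) ψ→(φ∨ψ); (Ax8) (φ→γ)→((ψ→γ)→((φ∨ψ)→γ)); (DN) ¬¬φ↔φ; (DM1) ¬(φ∨ψ)↔(¬φ∧¬ψ); (DM2) ¬(φ∧ψ)↔(¬φ∨¬ψ); (DM3) ¬(φ→ψ)↔(φ∧¬ψ); (AxP) φ∨(φ→ψ); where φ↔ψ abbreviates (φ→ψ)∧(ψ→φ). It is characterized by the 4-valued matrix on pairs (z1,z2) ∈ {0,1}², with designated values those with z1=1, and z∧w=(z1⊓w1, z2⊔w2), z∨w=(z1⊔w1, z2⊓w2), ¬z=(z2,z1), z→w=(z1⇒w1, z1⊓w2). Tm (Ivlev's 4-valued non-normal version of modal logic KT) is the logic over the signature {→, ∼,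 □} (∼ a classical negation) given by the Hilbert calculus with modus ponens and axiom schemas (Ax1), (Ax2), (Ax9) (∼ψ→∼φ)→((∼ψ→φ)→ψ), (K) □(φ→ψ)→(□φ→□ψ), (K1) □(φ→ψ)→(□∼ψ→□∼φ), (K2) □∼(φ→ψ)↔(□φ∧□∼ψ), (M1) (□∼φ∨□ψ)→□(φ→ψ), (T) □φ→φ, (DN1) □φ↔□∼∼φ, where in Tm φ∨ψ abbreviates ∼φ→ψ, φ∧ψ abbreviates ∼(φ→∼ψ), and φ↔ψ abbreviates ∼((φ→ψ)→∼(ψ→φ)). It is characterized by Ivlev's 4-valued non-deterministic matrix. IvFDE_T is the logic over the signature {∧, ∨, →, ¬, ∼, □} given by the Hilbert calculus containing modus ponens, all axiom schemas of IDM4, all axiom schemas of Tm (with ∧ and ∨ now primitive and ↔ abbreviating (φ→ψ)∧(ψ→φ)), plus: (N1) □(φ∧ψ)↔(□φ∧□ψ); (N2) □∼(φ∨ψ)↔□(∼φ∧∼ψ); (N3) (□∼φ∨□∼ψ)→□∼(φ∧ψ); (N4) (□φ∨□ψ)→□(φ∨ψ); (N5) □φ↔□∼¬φ; (N6) □∼φ↔□∼¬¬φ; (N7) □∼(φ∧ψ)→(□φ→□∼ψ); (N8) □∼(φ∧ψ)→(□ψ→□∼φ); (N9) □(φ∨ψ)→(□∼φ→□ψ); (N10) □(φ∨ψ)→(□∼ψ→□φ). It is sound and complete w.r.t. a 6-valued non-deterministic matrix whose truth-values are the tuples (z1,z2,z3,z4) ∈ {0,1}⁴ (representing the values of ξ,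 □ξ, □∼ξ, ¬ξ) with z2 ≤ z1, z1⊓z3=0, z2⊓z4=0, z3 ≤ z4, designated iff z1=1. *)

theory Defs
  imports Main
begin

text \<open>
  The axiom schemas of IDM4 and Tm are sets of formulas indexed by the operations that interpret
  the connectives, so that the expanded logic can take over the same schemas. This matters for Tm:
  there \<open>\<and>\<close>, \<open>\<or>\<close> and \<open>\<leftrightarrow>\<close> abbreviate formulas in \<open>\<rightarrow>\<close> and \<open>\<sim>\<close>, whereas in \<open>IvFDE_T\<close> the same schemas
  are read with primitive \<open>\<and>\<close> and \<open>\<or>\<close>.
\<close>

inductive_set idm4_schemas ::
  "('f \<Rightarrow> 'f \<Rightarrow> 'f) \<Rightarrow> ('f \<Rightarrow> 'f \<Rightarrow> 'f) \<Rightarrow> ('f \<Rightarrow> 'f \<Rightarrow> 'f) \<Rightarrow> ('f \<Rightarrow> 'f \<Rightarrow> 'f) \<Rightarrow> ('f \<Rightarrow> 'f) \<Rightarrow> 'f set"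
  for con (infixr \<open>\<^bold>\<and>\<close> 70) and dis (infixr \<open>\<^bold>\<or>\<close> 65) and imp (infixr \<open>\<^bold>\<rightarrow>\<close> 60)
    and iff (infix \<open>\<^bold>\<leftrightarrow>\<close> 55) and neg (\<open>\<^bold>\<not> _\<close> [80] 80)
  where
    Ax1: "\<phi> \<^bold>\<rightarrow> (\<psi> \<^bold>\<rightarrow> \<phi>) \<in> idm4_schemas con dis imp iff neg"
  | Ax2: "(\<phi> \<^bold>\<rightarrow> (\<psi> \<^bold>\<rightarrow> \<gamma>)) \<^bold>\<rightarrow> ((\<phi> \<^bold>\<rightarrow> \<psi>) \<^bold>\<rightarrow> (\<phi> \<^bold>\<rightarrow> \<gamma>)) \<in> idm4_schemas con dis imp iff neg"
  | Ax3: "\<phi> \<^bold>\<rightarrow> (\<psi> \<^bold>\<rightarrow> (\<phi> \<^bold>\<and> \<psi>)) \<in> idm4_schemas con dis imp iff neg"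
  | Ax4: "(\<phi> \<^bold>\<and> \<psi>) \<^bold>\<rightarrow> \<phi> \<in> idm4_schemas con dis imp iff neg"
  | Ax5: "(\<phi> \<^bold>\<and> \<psi>) \<^bold>\<rightarrow> \<psi> \<in> idm4_schemas con dis imp iff neg"
  | Ax6: "\<phi> \<^bold>\<rightarrow> (\<phi> \<^bold>\<or> \<psi>) \<in> idm4_schemas con dis imp iff neg"
  | Ax7: "\<psi> \<^bold>\<rightarrow> (\<phi> \<^bold>\<or> \<psi>) \<in> idm4_schemas con dis imp iff neg"
  | Ax8: "(\<phi> \<^bold>\<rightarrow> \<gamma>) \<^bold>\<rightarrow> ((\<psi> \<^bold>\<rightarrow> \<gamma>) \<^bold>\<rightarrow> ((\<phi> \<^bold>\<or> \<psi>) \<^bold>\<rightarrow> \<gamma>)) \<in> idm4_schemas con dis imp iff neg"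
  | DN: "\<^bold>\<not> (\<^bold>\<not> \<phi>) \<^bold>\<leftrightarrow> \<phi> \<in> idm4_schemas con dis imp iff neg"
  | DM1: "\<^bold>\<not> (\<phi> \<^bold>\<or> \<psi>) \<^bold>\<leftrightarrow> (\<^bold>\<not> \<phi> \<^bold>\<and> \<^bold>\<not> \<psi>) \<in> idm4_schemas con dis imp iff neg"
  | DM2: "\<^bold>\<not> (\<phi> \<^bold>\<and> \<psi>) \<^bold>\<leftrightarrow> (\<^bold>\<not> \<phi> \<^bold>\<or> \<^bold>\<not> \<psi>) \<in> idm4_schemas con dis imp iff neg"
  | DM3: "\<^bold>\<not> (\<phi> \<^bold>\<rightarrow> \<psi>) \<^bold>\<leftrightarrow> (\<phi> \<^bold>\<and> \<^bold>\<not> \<psi>) \<in> idm4_schemas con dis imp iff neg"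
  | AxP: "\<phi> \<^bold>\<or> (\<phi> \<^bold>\<rightarrow> \<psi>) \<in> idm4_schemas con dis imp iff neg"

inductive_set tm_schemas ::
  "('f \<Rightarrow> 'f \<Rightarrow> 'f) \<Rightarrow> ('f \<Rightarrow> 'f \<Rightarrow> 'f) \<Rightarrow> ('f \<Rightarrow> 'f \<Rightarrow> 'f) \<Rightarrow> ('f \<Rightarrow> 'f \<Rightarrow> 'f) \<Rightarrow>
    ('f \<Rightarrow> 'f) \<Rightarrow> ('f \<Rightarrow> 'f) \<Rightarrow> 'f set"
  for con (infixr \<open>\<^bold>\<and>\<close> 70) and dis (infixr \<open>\<^bold>\<or>\<close> 65) and imp (infixr \<open>\<^bold>\<rightarrow>\<close> 60)
    and iff (infix \<open>\<^bold>\<leftrightarrow>\<close> 55) and cneg (\<open>\<^bold>\<sim> _\<close> [80] 80) and box (\<open>\<^bold>\<box> _\<close> [80] 80)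
  where
    Ax1: "\<phi> \<^bold>\<rightarrow> (\<psi> \<^bold>\<rightarrow> \<phi>) \<in> tm_schemas con dis imp iff cneg box"
  | Ax2: "(\<phi> \<^bold>\<rightarrow> (\<psi> \<^bold>\<rightarrow> \<gamma>)) \<^bold>\<rightarrow> ((\<phi> \<^bold>\<rightarrow> \<psi>) \<^bold>\<rightarrow> (\<phi> \<^bold>\<rightarrow> \<gamma>)) \<in> tm_schemas con dis imp iff cneg box"
  | Ax9: "(\<^bold>\<sim> \<psi> \<^bold>\<rightarrow> \<^bold>\<sim> \<phi>) \<^bold>\<rightarrow> ((\<^bold>\<sim> \<psi> \<^bold>\<rightarrow> \<phi>) \<^bold>\<rightarrow> \<psi>) \<in> tm_schemas con dis imp iff cneg box"
  | K: "\<^bold>\<box> (\<phi> \<^bold>\<rightarrow> \<psi>) \<^bold>\<rightarrow> (\<^bold>\<box> \<phi> \<^bold>\<rightarrow> \<^bold>\<box> \<psi>) \<in> tm_schemas con dis imp iff cneg box"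
  | K1: "\<^bold>\<box> (\<phi> \<^bold>\<rightarrow> \<psi>) \<^bold>\<rightarrow> (\<^bold>\<box> (\<^bold>\<sim> \<psi>) \<^bold>\<rightarrow> \<^bold>\<box> (\<^bold>\<sim> \<phi>)) \<in> tm_schemas con dis imp iff cneg box"
  | K2: "\<^bold>\<box> (\<^bold>\<sim> (\<phi> \<^bold>\<rightarrow> \<psi>)) \<^bold>\<leftrightarrow> (\<^bold>\<box> \<phi> \<^bold>\<and> \<^bold>\<box> (\<^bold>\<sim> \<psi>)) \<in> tm_schemas con dis imp iff cneg box"
  | M1: "(\<^bold>\<box> (\<^bold>\<sim> \<phi>) \<^bold>\<or> \<^bold>\<box> \<psi>) \<^bold>\<rightarrow> \<^bold>\<box> (\<phi> \<^bold>\<rightarrow> \<psi>) \<in> tm_schemas con dis imp iff cneg box"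
  | T: "\<^bold>\<box> \<phi> \<^bold>\<rightarrow> \<phi> \<in> tm_schemas con dis imp iff cneg box"
  | DN1: "\<^bold>\<box> \<phi> \<^bold>\<leftrightarrow> \<^bold>\<box> (\<^bold>\<sim> (\<^bold>\<sim> \<phi>)) \<in> tm_schemas con dis imp iff cneg box"

inductive_set ivfde_t_schemas ::
  "('f \<Rightarrow> 'f \<Rightarrow> 'f) \<Rightarrow> ('f \<Rightarrow> 'f \<Rightarrow> 'f) \<Rightarrow> ('f \<Rightarrow> 'f \<Rightarrow> 'f) \<Rightarrow> ('f \<Rightarrow> 'f \<Rightarrow> 'f) \<Rightarrow>
    ('f \<Rightarrow> 'f) \<Rightarrow> ('f \<Rightarrow> 'f) \<Rightarrow> ('f \<Rightarrow> 'f) \<Rightarrow> 'f set"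
  for con (infixr \<open>\<^bold>\<and>\<close> 70) and dis (infixr \<open>\<^bold>\<or>\<close> 65) and imp (infixr \<open>\<^bold>\<rightarrow>\<close> 60)
    and iff (infix \<open>\<^bold>\<leftrightarrow>\<close> 55) and neg (\<open>\<^bold>\<not> _\<close> [80] 80) and cneg (\<open>\<^bold>\<sim> _\<close> [80] 80)
    and box (\<open>\<^bold>\<box> _\<close> [80] 80)
  where
    IDM4: "\<phi> \<in> idm4_schemas con dis imp iff neg \<Longrightarrow> \<phi> \<in> ivfde_t_schemas con dis imp iff neg cneg box"
  | Tm: "\<phi> \<in> tm_schemas con dis imp iff cneg box \<Longrightarrow> \<phi> \<in> ivfde_t_schemas con dis imp iff neg cneg box"
  | N1: "\<^bold>\<box> (\<phi> \<^bold>\<and> \<psi>) \<^bold>\<leftrightarrow> (\<^bold>\<box> \<phi> \<^bold>\<and> \<^bold>\<box> \<psi>) \<in> ivfde_t_schemas con dis imp iff neg cneg box"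
  | N2: "\<^bold>\<box> (\<^bold>\<sim> (\<phi> \<^bold>\<or> \<psi>)) \<^bold>\<leftrightarrow> \<^bold>\<box> (\<^bold>\<sim> \<phi> \<^bold>\<and> \<^bold>\<sim> \<psi>) \<in> ivfde_t_schemas con dis imp iff neg cneg box"
  | N3: "(\<^bold>\<box> (\<^bold>\<sim> \<phi>) \<^bold>\<or> \<^bold>\<box> (\<^bold>\<sim> \<psi>)) \<^bold>\<rightarrow> \<^bold>\<box> (\<^bold>\<sim> (\<phi> \<^bold>\<and> \<psi>)) \<in> ivfde_t_schemas con dis imp iff neg cneg box"
  | N4: "(\<^bold>\<box> \<phi> \<^bold>\<or> \<^bold>\<box> \<psi>) \<^bold>\<rightarrow> \<^bold>\<box> (\<phi> \<^bold>\<or> \<psi>) \<in> ivfde_t_schemas con dis imp iff neg cneg box"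
  | N5: "\<^bold>\<box> \<phi> \<^bold>\<leftrightarrow> \<^bold>\<box> (\<^bold>\<sim> (\<^bold>\<not> \<phi>)) \<in> ivfde_t_schemas con dis imp iff neg cneg box"
  | N6: "\<^bold>\<box> (\<^bold>\<sim> \<phi>) \<^bold>\<leftrightarrow> \<^bold>\<box> (\<^bold>\<sim> (\<^bold>\<not> (\<^bold>\<not> \<phi>))) \<in> ivfde_t_schemas con dis imp iff neg cneg box"
  | N7: "\<^bold>\<box> (\<^bold>\<sim> (\<phi> \<^bold>\<and> \<psi>)) \<^bold>\<rightarrow> (\<^bold>\<box> \<phi> \<^bold>\<rightarrow> \<^bold>\<box> (\<^bold>\<sim> \<psi>)) \<in> ivfde_t_schemas con dis imp iff neg cneg box"
  | N8: "\<^bold>\<box> (\<^bold>\<sim> (\<phi> \<^bold>\<and> \<psi>)) \<^bold>\<rightarrow> (\<^bold>\<box> \<psi> \<^bold>\<rightarrow> \<^bold>\<box> (\<^bold>\<sim> \<phi>)) \<in> ivfde_t_schemas con dis imp iff neg cneg box"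
  | N9: "\<^bold>\<box> (\<phi> \<^bold>\<or> \<psi>) \<^bold>\<rightarrow> (\<^bold>\<box> (\<^bold>\<sim> \<phi>) \<^bold>\<rightarrow> \<^bold>\<box> \<psi>) \<in> ivfde_t_schemas con dis imp iff neg cneg box"
  | N10: "\<^bold>\<box> (\<phi> \<^bold>\<or> \<psi>) \<^bold>\<rightarrow> (\<^bold>\<box> (\<^bold>\<sim> \<psi>) \<^bold>\<rightarrow> \<^bold>\<box> \<phi>) \<in> ivfde_t_schemas con dis imp iff neg cneg box"

inductive hilbert :: "'f set \<Rightarrow> ('f \<Rightarrow> 'f \<Rightarrow> 'f) \<Rightarrow> 'f set \<Rightarrow> 'f \<Rightarrow> bool"
  for Ax :: "'f set" and imp :: "'f \<Rightarrow> 'f \<Rightarrow> 'f" and \<Gamma> :: "'f set"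
  where
    axiom: "\<phi> \<in> Ax \<Longrightarrow> hilbert Ax imp \<Gamma> \<phi>"
  | premise: "\<phi> \<in> \<Gamma> \<Longrightarrow> hilbert Ax imp \<Gamma> \<phi>"
  | MP: "hilbert Ax imp \<Gamma> \<phi> \<Longrightarrow> hilbert Ax imp \<Gamma> (imp \<phi> \<psi>) \<Longrightarrow> hilbert Ax imp \<Gamma> \<psi>"

datatype 'v idm4_fm =
    DVar 'v
  | DAnd "'v idm4_fm" "'v idm4_fm"
  | DOr "'v idm4_fm" "'v idm4_fm"
  | DImp "'v idm4_fm" "'v idm4_fm"
  | DNeg "'v idm4_fm"

definition DIff :: "'v idm4_fm \<Rightarrow> 'v idm4_fm \<Rightarrow> 'v idm4_fm" where
  "DIff \<phi> \<psi> = DAnd (DImp \<phi> \<psi>) (DImp \<psi> \<phi>)"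

definition IDM4 :: "'v idm4_fm set \<Rightarrow> 'v idm4_fm \<Rightarrow> bool" where
  "IDM4 \<Gamma> \<phi> \<longleftrightarrow> hilbert (idm4_schemas DAnd DOr DImp DIff DNeg) DImp \<Gamma> \<phi>"

datatype 'v tm_fm =
    TVar 'v
  | TImp "'v tm_fm" "'v tm_fm"
  | TNot "'v tm_fm"
  | TBox "'v tm_fm"

definition TOr :: "'v tm_fm \<Rightarrow> 'v tm_fm \<Rightarrow> 'v tm_fm" where
  "TOr \<phi> \<psi> = TImp (TNot \<phi>) \<psi>"

definition TAnd :: "'v tm_fm \<Rightarrow> 'v tm_fm \<Rightarrow> 'v tm_fm" where
  "TAnd \<phi> \<psi> = TNot (TImp \<phi> (TNot \<psi>))"

definition TIff :: "'v tm_fm \<Rightarrow> 'v tm_fm \<Rightarrow> 'v tm_fm" where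
  "TIff \<phi> \<psi> = TNot (TImp (TImp \<phi> \<psi>) (TNot (TImp \<psi> \<phi>)))"

definition Tm :: "'v tm_fm set \<Rightarrow> 'v tm_fm \<Rightarrow> bool" where
  "Tm \<Gamma> \<phi> \<longleftrightarrow> hilbert (tm_schemas TAnd TOr TImp TIff TNot TBox) TImp \<Gamma> \<phi>"

datatype 'v fm =
    Var 'v
  | And "'v fm" "'v fm"
  | Or "'v fm" "'v fm"
  | Imp "'v fm" "'v fm"
  | Neg "'v fm"  \<comment> \<open>the FDE negation \<open>\<not>\<close>\<close>
  | CNot "'v fm"  \<comment> \<open>the classical negation \<open>\<sim>\<close>\<close>
  | Box "'v fm"

definition Iff :: "'v fm \<Rightarrow> 'v fm \<Rightarrow> 'v fm" where
  "Iff \<phi> \<psi> = And (Imp \<phi> \<psi>) (Imp \<psi> \<phi>)"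

definition IvFDE_T :: "'v fm set \<Rightarrow> 'v fm \<Rightarrow> bool" where
  "IvFDE_T \<Gamma> \<phi> \<longleftrightarrow> hilbert (ivfde_t_schemas And Or Imp Iff Neg CNot Box) Imp \<Gamma> \<phi>"

text \<open>
  Formulas over the smaller signatures are regarded as formulas over the full signature via the
  following inclusions.
\<close>

primrec of_idm4 :: "'v idm4_fm \<Rightarrow> 'v fm" where
  "of_idm4 (DVar p) = Var p"
| "of_idm4 (DAnd \<phi> \<psi>) = And (of_idm4 \<phi>) (of_idm4 \<psi>)"
| "of_idm4 (DOr \<phi> \<psi>) = Or (of_idm4 \<phi>) (of_idm4 \<psi>)"
| "of_idm4 (DImp \<phi> \<psi>) = Imp (of_idm4 \<phi>) (of_idm4 \<psi>)"
| "of_idm4 (DNeg \<phi>) = Neg (of_idm4 \<phi>)"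

primrec of_tm :: "'v tm_fm \<Rightarrow> 'v fm" where
  "of_tm (TVar p) = Var p"
| "of_tm (TImp \<phi> \<psi>) = Imp (of_tm \<phi>) (of_tm \<psi>)"
| "of_tm (TNot \<phi>) = CNot (of_tm \<phi>)"
| "of_tm (TBox \<phi>) = Box (of_tm \<phi>)"

end

theory Submission
  imports Defs
begin

text \<open>
  Both conservativity claims are shown by translating the full language back into the fragment.
  For Tm, reading \<open>\<and>\<close>, \<open>\<or>\<close>, \<open>\<not>\<close> as the defined connectives and as \<open>\<sim>\<close> makes every axiom of
  \<open>IvFDE_T\<close> a theorem. IDM4 has no falsum, so the translation depends on the formula \<open>\<chi>\<close> to be
  refuted: \<open>\<box>\<phi>\<close> becomes \<open>\<chi>\<close> and \<open>\<sim>\<phi>\<close> becomes \<open>\<phi> \<rightarrow> \<chi>\<close>, so that nothing is necessary wherever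
  \<open>\<chi>\<close> fails. The required theorems are classical consequences of the axioms and are obtained
  from a completeness theorem for two-valued valuations that respect only \<open>\<rightarrow>\<close> and treat all other
  formulas as atoms.
\<close>

section \<open>Hilbert derivability and two-valued valuations\<close>

lemma hilbert_mono: "hilbert Ax imp \<Gamma> \<phi> \<Longrightarrow> \<Gamma> \<subseteq> \<Delta> \<Longrightarrow> hilbert Ax imp \<Delta> \<phi>"
  by (induction rule: hilbert.induct) (auto intro: hilbert.intros)

text \<open>Derivations are finitary: in the \<open>MP\<close> case the two members of the chain are
  comparable, so the larger one derives both formulas. \<open>C \<noteq> {}\<close> provides a
  member in the axiom case.\<close>

lemma hilbert_chain_Union:
  assumes "hilbert Ax imp (\<Union>C) \<phi>" "subset.chain S C" "C \<noteq> {}"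
  shows "\<exists>\<Delta>\<in>C. hilbert Ax imp \<Delta> \<phi>"
  using assms
proof (induction rule: hilbert.induct)
  case (MP \<phi> \<psi>)
  then obtain D E where DE: "D \<in> C" "E \<in> C" "hilbert Ax imp D \<phi>" "hilbert Ax imp E (imp \<phi> \<psi>)"
    by blast
  with MP.prems have "D \<subseteq> E \<or> E \<subseteq> D"
    by (auto simp: subset_chain_def)
  with DE show ?case
    by (meson hilbert.MP hilbert_mono)
qed (auto intro: hilbert.intros)

definition bivaluation :: "'f set \<Rightarrow> ('f \<Rightarrow> 'f \<Rightarrow> 'f) \<Rightarrow> ('f \<Rightarrow> bool) \<Rightarrow> bool" where
  "bivaluation Ax imp v \<longleftrightarrow> (\<forall>\<phi> \<psi>. v (imp \<phi> \<psi>) \<longleftrightarrow> (v \<phi> \<longrightarrow> v \<psi>)) \<and> (\<forall>\<phi>\<in>Ax. v \<phi>)"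

lemma bivaluation_imp: "bivaluation Ax imp v \<Longrightarrow> v (imp \<phi> \<psi>) \<longleftrightarrow> (v \<phi> \<longrightarrow> v \<psi>)"
  by (simp add: bivaluation_def)

lemma bivaluation_axiom: "bivaluation Ax imp v \<Longrightarrow> \<phi> \<in> Ax \<Longrightarrow> v \<phi>"
  by (simp add: bivaluation_def)

lemma hilbert_sound:
  "hilbert Ax imp \<Gamma> \<phi> \<Longrightarrow> bivaluation Ax imp v \<Longrightarrow> \<forall>\<gamma>\<in>\<Gamma>. v \<gamma> \<Longrightarrow> v \<phi>"
  by (induction rule: hilbert.induct) (auto simp: bivaluation_def)

section \<open>Deduction theorem and completeness for implicational logics\<close>

locale implicative =
  fixes Ax :: "'f set" and imp :: "'f \<Rightarrow> 'f \<Rightarrow> 'f"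
  assumes weaken: "imp \<phi> (imp \<psi> \<phi>) \<in> Ax"
    and distrib: "imp (imp \<phi> (imp \<psi> \<gamma>)) (imp (imp \<phi> \<psi>) (imp \<phi> \<gamma>)) \<in> Ax"
begin

lemma hilbert_const: "hilbert Ax imp \<Gamma> \<psi> \<Longrightarrow> hilbert Ax imp \<Gamma> (imp \<phi> \<psi>)"
  by (meson hilbert.axiom hilbert.MP weaken)

lemma hilbert_refl: "hilbert Ax imp \<Gamma> (imp \<phi> \<phi>)"
  by (meson hilbert.axiom hilbert.MP weaken distrib)

lemma deduction: "hilbert Ax imp (insert \<phi> \<Gamma>) \<psi> \<Longrightarrow> hilbert Ax imp \<Gamma> (imp \<phi> \<psi>)"
proof (induction rule: hilbert.induct)
  case (axiom \<psi>)
  then show ?case by (simp add: hilbert.axiom hilbert_const)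
next
  case (premise \<psi>)
  then show ?case by (auto intro: hilbert.premise hilbert_const hilbert_refl)
next
  case (MP \<gamma> \<psi>)
  then show ?case by (meson distrib hilbert.axiom hilbert.MP)
qed

end

text \<open>The assumption \<open>by_cases\<close> is Peirce's law, in the form of a case distinction.\<close>

locale classical_implicative = implicative +
  assumes by_cases:
    "hilbert Ax imp \<Gamma> (imp \<phi> \<gamma>) \<Longrightarrow> hilbert Ax imp \<Gamma> (imp (imp \<phi> \<psi>) \<gamma>) \<Longrightarrow> hilbert Ax imp \<Gamma> \<gamma>"
begin

text \<open>Lindenbaum's construction: Zorn's lemma yields a maximal superset of \<Gamma> not
  deriving \<phi>, and membership in it is the valuation. By maximality every formula outside it
  implies \<phi>, so \<phi> acts as a falsum.\<close>

lemma countermodel: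
  assumes unprovable: "\<not> hilbert Ax imp \<Gamma> \<phi>"
  obtains v where "bivaluation Ax imp v" "\<forall>\<gamma>\<in>\<Gamma>. v \<gamma>" "\<not> v \<phi>"
proof -
  define S where "S = {\<Delta>. \<Gamma> \<subseteq> \<Delta> \<and> \<not> hilbert Ax imp \<Delta> \<phi>}"
  have "\<exists>M\<in>S. \<forall>X\<in>S. M \<subseteq> X \<longrightarrow> X = M"
  proof (rule subset_Zorn_nonempty)
    show "S \<noteq> {}" using unprovable by (auto simp: S_def)
    fix C assume C: "C \<noteq> {}" "subset.chain S C"
    then have "C \<subseteq> S" by (simp add: subset_chain_def)
    with C show "\<Union>C \<in> S"
      using hilbert_chain_Union[OF _ C(2) C(1)] by (fastforce simp: S_def)
  qed
  then obtain \<Delta> where \<Delta>: "\<Gamma> \<subseteq> \<Delta>" "\<not> hilbert Ax imp \<Delta> \<phi>"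
    and max: "\<And>X. \<Delta> \<subseteq> X \<Longrightarrow> \<not> hilbert Ax imp X \<phi> \<Longrightarrow> X = \<Delta>"
    unfolding S_def by (smt (verit) mem_Collect_eq subset_trans)
  have imp_\<phi>: "hilbert Ax imp \<Delta> (imp \<psi> \<phi>)" if "\<psi> \<notin> \<Delta>" for \<psi>
    using max[of "insert \<psi> \<Delta>"] that deduction by blast
  have closed: "\<psi> \<in> \<Delta>" if "hilbert Ax imp \<Delta> \<psi>" for \<psi>
    using imp_\<phi> that \<Delta>(2) hilbert.MP by metis
  \<comment> \<open>If \<psi> and \<open>imp \<psi> \<gamma>\<close> were both outside \<Delta>,
    both would imply \<phi> and \<open>by_cases\<close> would derive \<phi>.\<close>
  have "imp \<psi> \<gamma> \<in> \<Delta> \<longleftrightarrow> (\<psi> \<in> \<Delta> \<longrightarrow> \<gamma> \<in> \<Delta>)" for \<psi> \<gamma>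
    by (metis by_cases closed imp_\<phi> \<Delta>(2) hilbert.premise hilbert.MP hilbert_const)
  then have "bivaluation Ax imp (\<lambda>\<psi>. \<psi> \<in> \<Delta>)"
    by (auto simp: bivaluation_def intro: closed hilbert.axiom)
  moreover have "\<phi> \<notin> \<Delta>"
    using \<Delta>(2) hilbert.premise by metis
  ultimately show thesis
    using that \<Delta>(1) by (metis subsetD)
qed

end

section \<open>Peirce's law from the axioms of either logic\<close>

lemma idm4_classical_implicative:
  assumes "idm4_schemas con dis imp bic neg \<subseteq> Ax"
  shows "classical_implicative Ax imp"
proof -
  interpret implicative Ax imp
    by unfold_locales (use assms in \<open>auto intro: idm4_schemas.intros\<close>)
  show ?thesis
  proof unfold_locales
    fix \<Gamma> \<phi> \<gamma> \<psi>
    assume "hilbert Ax imp \<Gamma> (imp \<phi> \<gamma>)" "hilbert Ax imp \<Gamma> (imp (imp \<phi> \<psi>) \<gamma>)"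
    \<comment> \<open>\<open>AxP\<close> supplies the two cases, and \<open>Ax8\<close> eliminates
      the disjunction.\<close>
    moreover have "hilbert Ax imp \<Gamma> (dis \<phi> (imp \<phi> \<psi>))"
      using assms by (intro hilbert.axiom) (auto intro: idm4_schemas.AxP)
    moreover have "hilbert Ax imp \<Gamma>
        (imp (imp \<phi> \<gamma>) (imp (imp (imp \<phi> \<psi>) \<gamma>) (imp (dis \<phi> (imp \<phi> \<psi>)) \<gamma>)))"
      using assms by (intro hilbert.axiom) (auto intro: idm4_schemas.Ax8)
    ultimately show "hilbert Ax imp \<Gamma> \<gamma>"
      by (meson hilbert.MP)
  qed
qed

lemma tm_classical_implicative:
  assumes "tm_schemas con dis imp bic cneg box \<subseteq> Ax"
  shows "classical_implicative Ax imp"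
proof -
  interpret implicative Ax imp
    by unfold_locales (use assms in \<open>auto intro: tm_schemas.intros\<close>)
  have contra: "hilbert Ax imp \<Gamma> \<psi>"
    if "hilbert Ax imp \<Gamma> (imp (cneg \<psi>) (cneg \<phi>))" "hilbert Ax imp \<Gamma> (imp (cneg \<psi>) \<phi>)" for \<Gamma> \<phi> \<psi>
  proof -
    have "hilbert Ax imp \<Gamma>
        (imp (imp (cneg \<psi>) (cneg \<phi>)) (imp (imp (cneg \<psi>) \<phi>) \<psi>))"
      using assms by (intro hilbert.axiom) (auto intro: tm_schemas.Ax9)
    with that show ?thesis by (meson hilbert.MP)
  qed
  show ?thesis
  proof unfold_locales
    fix \<Gamma> \<phi> \<gamma> \<psi>
    assume prems: "hilbert Ax imp \<Gamma> (imp \<phi> \<gamma>)" "hilbert Ax imp \<Gamma> (imp (imp \<phi> \<psi>) \<gamma>)"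
    let ?\<Delta> = "insert (cneg \<gamma>) \<Gamma>"
    have "hilbert Ax imp (insert \<phi> ?\<Delta>) \<gamma>"
      using hilbert_mono[OF prems(1)] by (meson hilbert.MP hilbert.premise insertI1 subset_insertI2 subset_refl)
    moreover have "hilbert Ax imp (insert \<phi> ?\<Delta>) (cneg \<gamma>)"
      by (simp add: hilbert.premise)
    \<comment> \<open>Explosion: \<gamma> and its negation, weakened to consequences of
      \<open>cneg \<psi>\<close>, give \<psi> by \<open>contra\<close>.\<close>
    ultimately have "hilbert Ax imp ?\<Delta> (imp \<phi> \<psi>)"
      by (intro deduction contra[of _ \<psi> \<gamma>] hilbert_const)
    then have "hilbert Ax imp ?\<Delta> \<gamma>"
      using hilbert_mono[OF prems(2)] by (meson hilbert.MP subset_insertI)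
    then show "hilbert Ax imp \<Gamma> \<gamma>"
      by (rule contra[OF hilbert_refl deduction])
  qed
qed

section \<open>Truth conditions forced by the axioms\<close>

lemma
  assumes "bivaluation Ax imp v" "idm4_schemas con dis imp bic neg \<subseteq> Ax"
  shows bivaluation_con: "v (con \<phi> \<psi>) \<longleftrightarrow> v \<phi> \<and> v \<psi>"
    and bivaluation_dis: "v (dis \<phi> \<psi>) \<longleftrightarrow> v \<phi> \<or> v \<psi>"
proof -
  have ax: "v \<gamma>" if "\<gamma> \<in> idm4_schemas con dis imp bic neg" for \<gamma>
    using assms that by (blast intro: bivaluation_axiom)
  note [simp] = bivaluation_imp[OF assms(1)]
  show "v (con \<phi> \<psi>) \<longleftrightarrow> v \<phi> \<and> v \<psi>"
    using ax[OF idm4_schemas.Ax3, of \<phi> \<psi>] ax[OF idm4_schemas.Ax4, of \<phi> \<psi>]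
      ax[OF idm4_schemas.Ax5, of \<phi> \<psi>] by auto
  \<comment> \<open>\<open>Ax8\<close> is instantiated with conclusion \<phi>: when both disjuncts
    fail, the disjunction implies the false formula \<phi>.\<close>
  show "v (dis \<phi> \<psi>) \<longleftrightarrow> v \<phi> \<or> v \<psi>"
    using ax[OF idm4_schemas.Ax6, of \<phi> \<psi>] ax[OF idm4_schemas.Ax7, of \<psi> \<phi>]
      ax[OF idm4_schemas.Ax8, of \<phi> \<phi> \<psi>] by auto
qed

text \<open>The constantly true valuation is a bivaluation, hence the assumption that some \<open>\<chi>\<close> fails.\<close>

lemma bivaluation_cneg:
  assumes "bivaluation Ax imp v" "tm_schemas con dis imp bic cneg box \<subseteq> Ax" "\<not> v \<chi>"
  shows "v (cneg \<phi>) \<longleftrightarrow> \<not> v \<phi>"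
proof -
  have "v (imp (imp (cneg \<psi>) (cneg \<phi>)) (imp (imp (cneg \<psi>) \<phi>) \<psi>))" for \<psi>
    using assms(1,2) by (blast intro: bivaluation_axiom tm_schemas.Ax9)
  \<comment> \<open>The instance at \<chi> excludes that \<phi> and \<open>cneg \<phi>\<close> both
    hold, since \<chi> would follow; the instance at \<phi> excludes that both fail.\<close>
  from this[of \<chi>] this[of \<phi>] show ?thesis
    using assms(3) by (auto simp: bivaluation_imp[OF assms(1)])
qed

section \<open>Axiom schemas under homomorphisms\<close>

lemma idm4_schemas_hom:
  assumes "\<phi> \<in> idm4_schemas con dis imp bic neg"
    and "\<And>\<phi> \<psi>. h (con \<phi> \<psi>) = con' (h \<phi>) (h \<psi>)" "\<And>\<phi> \<psi>. h (dis \<phi> \<psi>) = dis' (h \<phi>) (h \<psi>)"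
    and "\<And>\<phi> \<psi>. h (imp \<phi> \<psi>) = imp' (h \<phi>) (h \<psi>)" "\<And>\<phi> \<psi>. h (bic \<phi> \<psi>) = bic' (h \<phi>) (h \<psi>)"
    and "\<And>\<phi>. h (neg \<phi>) = neg' (h \<phi>)"
  shows "h \<phi> \<in> idm4_schemas con' dis' imp' bic' neg'"
  using assms(1) by cases (simp_all add: assms(2-) idm4_schemas.intros)

lemma tm_schemas_hom:
  assumes "\<phi> \<in> tm_schemas con dis imp bic cneg box"
    and "\<And>\<phi> \<psi>. h (con \<phi> \<psi>) = con' (h \<phi>) (h \<psi>)" "\<And>\<phi> \<psi>. h (dis \<phi> \<psi>) = dis' (h \<phi>) (h \<psi>)"
    and "\<And>\<phi> \<psi>. h (imp \<phi> \<psi>) = imp' (h \<phi>) (h \<psi>)" "\<And>\<phi> \<psi>. h (bic \<phi> \<psi>) = bic' (h \<phi>) (h \<psi>)"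
    and "\<And>\<phi>. h (cneg \<phi>) = cneg' (h \<phi>)" "\<And>\<phi>. h (box \<phi>) = box' (h \<phi>)"
  shows "h \<phi> \<in> tm_schemas con' dis' imp' bic' cneg' box'"
  using assms(1) by cases (simp_all add: assms(2-) tm_schemas.intros)

section \<open>Translations between the languages and pulled-back valuations\<close>

abbreviation idm4_axioms :: "'v idm4_fm set" where
  "idm4_axioms \<equiv> idm4_schemas DAnd DOr DImp DIff DNeg"

abbreviation tm_axioms :: "'v tm_fm set" where
  "tm_axioms \<equiv> tm_schemas TAnd TOr TImp TIff TNot TBox"

abbreviation ivfde_t_axioms :: "'v fm set" where
  "ivfde_t_axioms \<equiv> ivfde_t_schemas And Or Imp Iff Neg CNot Box"

interpretation idm4: classical_implicative idm4_axioms DImp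
  by (rule idm4_classical_implicative) (rule subset_refl)

interpretation tm: classical_implicative tm_axioms TImp
  by (rule tm_classical_implicative) (rule subset_refl)

interpretation ivfde: classical_implicative ivfde_t_axioms Imp
  by (rule idm4_classical_implicative) (auto intro: ivfde_t_schemas.IDM4)

primrec to_idm4 :: "'v idm4_fm \<Rightarrow> 'v fm \<Rightarrow> 'v idm4_fm" where
  "to_idm4 \<chi> (Var p) = DVar p"
| "to_idm4 \<chi> (And \<phi> \<psi>) = DAnd (to_idm4 \<chi> \<phi>) (to_idm4 \<chi> \<psi>)"
| "to_idm4 \<chi> (Or \<phi> \<psi>) = DOr (to_idm4 \<chi> \<phi>) (to_idm4 \<chi> \<psi>)"
| "to_idm4 \<chi> (Imp \<phi> \<psi>) = DImp (to_idm4 \<chi> \<phi>) (to_idm4 \<chi> \<psi>)"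
| "to_idm4 \<chi> (Neg \<phi>) = DNeg (to_idm4 \<chi> \<phi>)"
| "to_idm4 \<chi> (CNot \<phi>) = DImp (to_idm4 \<chi> \<phi>) \<chi>"
| "to_idm4 \<chi> (Box \<phi>) = \<chi>"

lemma to_idm4_of_idm4: "to_idm4 \<chi> (of_idm4 \<phi>) = \<phi>"
  by (induction \<phi>) simp_all

primrec to_tm :: "'v fm \<Rightarrow> 'v tm_fm" where
  "to_tm (Var p) = TVar p"
| "to_tm (And \<phi> \<psi>) = TAnd (to_tm \<phi>) (to_tm \<psi>)"
| "to_tm (Or \<phi> \<psi>) = TOr (to_tm \<phi>) (to_tm \<psi>)"
| "to_tm (Imp \<phi> \<psi>) = TImp (to_tm \<phi>) (to_tm \<psi>)"
| "to_tm (Neg \<phi>) = TNot (to_tm \<phi>)"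
| "to_tm (CNot \<phi>) = TNot (to_tm \<phi>)"
| "to_tm (Box \<phi>) = TBox (to_tm \<phi>)"

lemma to_tm_of_tm: "to_tm (of_tm \<phi>) = \<phi>"
  by (induction \<phi>) simp_all

text \<open>Since \<chi> fails, \<open>CNot\<close> becomes Boolean complement and every boxed
  formula is false. Each modal axiom is then an implication with false antecedent or an equivalence
  of falsehoods.\<close>

lemma bivaluation_to_idm4:
  fixes v :: "'v idm4_fm \<Rightarrow> bool"
  assumes v: "bivaluation idm4_axioms DImp v" and \<chi>: "\<not> v \<chi>"
  shows "bivaluation ivfde_t_axioms Imp (\<lambda>\<phi>. v (to_idm4 \<chi> \<phi>))"
proof -
  note [simp] = \<chi> bivaluation_imp[OF v] bivaluation_con[OF v subset_refl]
    bivaluation_dis[OF v subset_refl]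
  have "v (to_idm4 \<chi> \<phi>)" if "\<phi> \<in> ivfde_t_axioms" for \<phi>
    using that
  proof cases
    case IDM4
    then have "to_idm4 \<chi> \<phi> \<in> idm4_axioms"
      by (rule idm4_schemas_hom) (simp_all add: Iff_def DIff_def)
    then show ?thesis by (rule bivaluation_axiom[OF v])
  next
    case Tm
    then show ?thesis by cases (simp_all add: Iff_def)
  qed (simp_all add: Iff_def)
  then show ?thesis by (simp add: bivaluation_def)
qed

text \<open>With both negations classical, the \<open>IDM4\<close> axioms become tautologies. The
  axioms \<open>N1\<close> to \<open>N10\<close> reduce to \<open>K\<close>, \<open>K1\<close>,
  \<open>K2\<close> and \<open>M1\<close> once \<open>DN1\<close> removes double negations below a
  box.\<close>

lemma bivaluation_to_tm:
  fixes v :: "'v tm_fm \<Rightarrow> bool"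
  assumes v: "bivaluation tm_axioms TImp v" and \<chi>: "\<not> v \<chi>"
  shows "bivaluation ivfde_t_axioms Imp (\<lambda>\<phi>. v (to_tm \<phi>))"
proof -
  note [simp] = bivaluation_imp[OF v] bivaluation_cneg[OF v subset_refl \<chi>]
  have [simp]: "v (TAnd \<phi> \<psi>) \<longleftrightarrow> v \<phi> \<and> v \<psi>" "v (TOr \<phi> \<psi>) \<longleftrightarrow> v \<phi> \<or> v \<psi>"
    "v (TIff \<phi> \<psi>) \<longleftrightarrow> (v \<phi> \<longleftrightarrow> v \<psi>)" for \<phi> \<psi>
    by (auto simp: TAnd_def TOr_def TIff_def)
  note ax = bivaluation_axiom[OF v]
  have [simp]: "v (TBox (TNot (TNot \<phi>))) \<longleftrightarrow> v (TBox \<phi>)" for \<phi>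
    using ax[OF tm_schemas.DN1, of \<phi>] by simp
  have [simp]: "v (TBox (TNot (TImp \<phi> \<psi>))) \<longleftrightarrow> v (TBox \<phi>) \<and> v (TBox (TNot \<psi>))" for \<phi> \<psi>
    using ax[OF tm_schemas.K2, of \<phi> \<psi>] by simp
  have K: "v (TBox (TImp \<phi> \<psi>)) \<Longrightarrow> v (TBox \<phi>) \<Longrightarrow> v (TBox \<psi>)"
    and K1: "v (TBox (TImp \<phi> \<psi>)) \<Longrightarrow> v (TBox (TNot \<psi>)) \<Longrightarrow> v (TBox (TNot \<phi>))"
    and M1: "v (TBox (TNot \<phi>)) \<or> v (TBox \<psi>) \<Longrightarrow> v (TBox (TImp \<phi> \<psi>))" for \<phi> \<psi>
    using ax[OF tm_schemas.K, of \<phi> \<psi>] ax[OF tm_schemas.K1, of \<phi> \<psi>]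
      ax[OF tm_schemas.M1, of \<phi> \<psi>] by simp_all
  \<comment> \<open>Instances at negated formulas, restated with the double negations already
    removed, as simplification leaves them.\<close>
  have K1': "v (TBox (TImp (TNot \<phi>) \<psi>)) \<Longrightarrow> v (TBox (TNot \<psi>)) \<Longrightarrow> v (TBox \<phi>)"
    and K1'': "v (TBox (TImp \<phi> (TNot \<psi>))) \<Longrightarrow> v (TBox \<psi>) \<Longrightarrow> v (TBox (TNot \<phi>))"
    and M1': "v (TBox \<phi>) \<or> v (TBox \<psi>) \<Longrightarrow> v (TBox (TImp (TNot \<phi>) \<psi>))" for \<phi> \<psi>
    using K1[of "TNot \<phi>" \<psi>] K1[of \<phi> "TNot \<psi>"] M1[of "TNot \<phi>" \<psi>] by simp_all
  have "v (to_tm \<phi>)" if "\<phi> \<in> ivfde_t_axioms" for \<phi>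
    using that
  proof cases
    case IDM4
    then show ?thesis by cases (auto simp: Iff_def)
  next
    case Tm
    then have "to_tm \<phi> \<in> tm_axioms"
      by (rule tm_schemas_hom) (simp_all add: Iff_def TAnd_def TIff_def)
    then show ?thesis by (rule bivaluation_axiom[OF v])
  next
    case N7
    then show ?thesis by (auto simp: TAnd_def dest: K)
  next
    case N8
    then show ?thesis by (auto simp: TAnd_def dest: K1'')
  next
    case N9
    then show ?thesis by (auto simp: TOr_def dest: K)
  next
    case N10
    then show ?thesis by (auto simp: TOr_def dest: K1')
  next
    case N1
    \<comment> \<open>Connectives outside the boxes are evaluated first; those left under a box are
      then unfolded, so that \<open>K2\<close> and \<open>DN1\<close> can rewrite them.\<close>
    then show ?thesis by (simp add: Iff_def) (simp add: TAnd_def)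
  next
    case N2
    then show ?thesis by (simp add: Iff_def) (simp add: TAnd_def TOr_def)
  next
    case N3
    then show ?thesis by simp (auto simp: TAnd_def intro: M1)
  next
    case N4
    then show ?thesis by simp (auto simp: TOr_def intro: M1')
  qed (simp_all add: Iff_def)
  then show ?thesis by (simp add: bivaluation_def)
qed

text \<open>\<open>of_tm\<close> sends \<open>TAnd\<close>, \<open>TOr\<close> and
  \<open>TIff\<close> to formulas in \<open>Imp\<close> and \<open>CNot\<close>, not to
  \<open>And\<close>, \<open>Or\<close> and \<open>Iff\<close>, so axioms need not become axioms.
  All these occur outside boxes in the schemas, so agreement of truth values suffices.\<close>

lemma bivaluation_of_tm:
  fixes v :: "'v fm \<Rightarrow> bool"
  assumes v: "bivaluation ivfde_t_axioms Imp v" and \<chi>: "\<not> v \<chi>"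
  shows "bivaluation tm_axioms TImp (\<lambda>\<phi>. v (of_tm \<phi>))"
proof -
  have idm4: "idm4_schemas And Or Imp Iff Neg \<subseteq> ivfde_t_axioms"
    and tm: "tm_schemas And Or Imp Iff CNot Box \<subseteq> ivfde_t_axioms"
    by (auto intro: ivfde_t_schemas.IDM4 ivfde_t_schemas.Tm)
  note [simp] = bivaluation_imp[OF v] bivaluation_con[OF v idm4] bivaluation_dis[OF v idm4]
    bivaluation_cneg[OF v tm \<chi>]
  have [simp]: "v (Iff \<phi> \<psi>) \<longleftrightarrow> (v \<phi> \<longleftrightarrow> v \<psi>)" for \<phi> \<psi>
    by (auto simp: Iff_def)
  have [simp]: "v (of_tm (TAnd \<phi> \<psi>)) \<longleftrightarrow> v (of_tm \<phi>) \<and> v (of_tm \<psi>)"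
    "v (of_tm (TOr \<phi> \<psi>)) \<longleftrightarrow> v (of_tm \<phi>) \<or> v (of_tm \<psi>)"
    "v (of_tm (TIff \<phi> \<psi>)) \<longleftrightarrow> (v (of_tm \<phi>) \<longleftrightarrow> v (of_tm \<psi>))" for \<phi> \<psi>
    by (auto simp: TAnd_def TOr_def TIff_def)
  have ax: "v \<phi>" if "\<phi> \<in> tm_schemas And Or Imp Iff CNot Box" for \<phi>
    using that tm by (blast intro: bivaluation_axiom[OF v])
  have "v (of_tm \<phi>)" if "\<phi> \<in> tm_axioms" for \<phi>
    using that
  proof cases
    case (K \<alpha> \<beta>)
    then show ?thesis
      using ax[OF tm_schemas.K, of "of_tm \<alpha>" "of_tm \<beta>"] by simp
  next
    case (K1 \<alpha> \<beta>)
    then show ?thesis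
      using ax[OF tm_schemas.K1, of "of_tm \<alpha>" "of_tm \<beta>"] by simp
  next
    case (K2 \<alpha> \<beta>)
    then show ?thesis
      using ax[OF tm_schemas.K2, of "of_tm \<alpha>" "of_tm \<beta>"] by simp
  next
    case (M1 \<alpha> \<beta>)
    then show ?thesis
      using ax[OF tm_schemas.M1, of "of_tm \<alpha>" "of_tm \<beta>"] by simp
  next
    case (T \<alpha>)
    then show ?thesis
      using ax[OF tm_schemas.T, of "of_tm \<alpha>"] by simp
  next
    case (DN1 \<alpha>)
    then show ?thesis
      using ax[OF tm_schemas.DN1, of "of_tm \<alpha>"] by simp
  qed auto
  then show ?thesis by (simp add: bivaluation_def)
qed

section \<open>Conservativity over both fragments\<close>

theorem mainTheorem3:
  "(\<forall>(\<Gamma> :: 'v idm4_fm set) \<phi>. IvFDE_T (of_idm4 ` \<Gamma>) (of_idm4 \<phi>) \<longleftrightarrow> IDM4 \<Gamma> \<phi>) \<and>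
   (\<forall>(\<Gamma> :: 'v tm_fm set) \<phi>. IvFDE_T (of_tm ` \<Gamma>) (of_tm \<phi>) \<longleftrightarrow> Tm \<Gamma> \<phi>)"
proof (intro conjI allI iffI)
  fix \<Gamma> :: "'v idm4_fm set" and \<phi>
  assume prov: "IvFDE_T (of_idm4 ` \<Gamma>) (of_idm4 \<phi>)"
  show "IDM4 \<Gamma> \<phi>"
  proof (rule ccontr)
    assume "\<not> IDM4 \<Gamma> \<phi>"
    then obtain v where v: "bivaluation idm4_axioms DImp v" "\<forall>\<gamma>\<in>\<Gamma>. v \<gamma>" "\<not> v \<phi>"
      unfolding IDM4_def by (rule idm4.countermodel)
    \<comment> \<open>The underivable \<phi> itself is taken as \<chi>: it fails under
      \<open>v\<close>.\<close>
    show False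
      using hilbert_sound[OF prov[unfolded IvFDE_T_def] bivaluation_to_idm4[OF v(1,3)]] v(2,3)
      by (simp add: to_idm4_of_idm4)
  qed
next
  fix \<Gamma> :: "'v idm4_fm set" and \<phi>
  have axiom: "of_idm4 \<psi> \<in> ivfde_t_axioms" if "\<psi> \<in> idm4_axioms" for \<psi> :: "'v idm4_fm"
    by (rule ivfde_t_schemas.IDM4, rule idm4_schemas_hom[OF that]) (simp_all add: Iff_def DIff_def)
  assume "IDM4 \<Gamma> \<phi>"
  then show "IvFDE_T (of_idm4 ` \<Gamma>) (of_idm4 \<phi>)"
    unfolding IDM4_def IvFDE_T_def
    by (induction rule: hilbert.induct) (auto intro: axiom hilbert.intros)
next
  fix \<Gamma> :: "'v tm_fm set" and \<phi>
  assume prov: "IvFDE_T (of_tm ` \<Gamma>) (of_tm \<phi>)"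
  show "Tm \<Gamma> \<phi>"
  proof (rule ccontr)
    assume "\<not> Tm \<Gamma> \<phi>"
    then obtain v where v: "bivaluation tm_axioms TImp v" "\<forall>\<gamma>\<in>\<Gamma>. v \<gamma>" "\<not> v \<phi>"
      unfolding Tm_def by (rule tm.countermodel)
    show False
      using hilbert_sound[OF prov[unfolded IvFDE_T_def] bivaluation_to_tm[OF v(1,3)]] v(2,3)
      by (simp add: to_tm_of_tm)
  qed
next
  fix \<Gamma> :: "'v tm_fm set" and \<phi>
  assume prov: "Tm \<Gamma> \<phi>"
  show "IvFDE_T (of_tm ` \<Gamma>) (of_tm \<phi>)"
  proof (rule ccontr)
    assume "\<not> IvFDE_T (of_tm ` \<Gamma>) (of_tm \<phi>)"
    then obtain v where v: "bivaluation ivfde_t_axioms Imp v" "\<forall>\<gamma>\<in>of_tm ` \<Gamma>. v \<gamma>" "\<not> v (of_tm \<phi>)"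
      unfolding IvFDE_T_def by (rule ivfde.countermodel)
    show False
      using hilbert_sound[OF prov[unfolded Tm_def] bivaluation_of_tm[OF v(1,3)]] v(2,3)
      by simp
  qed
qed

end
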